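(* Let $D$ be a set and let $X$ be a real linear space. For every admissible function $f\colon D\to X$, the generalized Bajraktarević mean $\mathscr{B}_f\colon\mathscr{W}(D)\to D$ is casuative.
   Context: Notation: $\mathbb{R}_+=(0,+\infty)$; $W_n=[0,+\infty)^n\setminus\{(0,\dots,0)\}$; $\mathscr{W}(D)=\bigcup_{n=1}^\infty D^n\times W_n$. For $(x,\lambda)\in D^n\times W_n$ and $(y,\mu)\in D\times(0,+\infty)$, $((x,y),(\lambda,\mu))\in D^{n+1}\times W_{n+1}$ denotes the concatenation. Admissible functions and generalized Bajraktarević means: For a nonzero $x$ in a real linear space $X$, the ray generated by $x$ is $R_x=\{\lambda x\mid\lambda\in\mathbb{R}_+\}$. For $S\subseteq X$, $\operatorname{cone}(S)=\{\lambda x\mid \lambda\in\mathbb{R}_+,\ x\in S\}$. The set $S$ is observable if the rays generated by any two distinct elements of $S$ are disjoint, and conically convex if $\operatorname{cone}(S)$ is convex and $0\notin\operatorname{conv}(S)$. A function $f\colon D\to X$ is admissible if it is injective and $f(D)$ is observable and conically convex. For such $f$, $\pi_f\colon\operatorname{cone}(f(D))\to f(D)$ maps $y$ to the unique point $x\in f(D)$ with $y\in R_x$, and $f^{(-1)}:=f^{-1}\circ\pi_f\colon\operatorname{cone}(f(D))\to D$. For $(x,\lambda)\in D^n\times W_n$ put $\mathscr{B}_f(x,\lambda)=f^{(-1)}\big(\sum_{k=1}^n\lambda_kf(x_k)\big)$. Casuativity: $\mathscr{M}\colon\mathscr{W}(D)\to D$ is casuative if for all $(x,\lambda)\in\mathscr{W}(D)$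 and all $(y,\mu)\in D\times(0,+\infty)$, one has $\mathscr{M}(x,\lambda)=\mathscr{M}((x,y),(\lambda,\mu))$ if and only if $y=\mathscr{M}(x,\lambda)$. *)

theory Defs
  imports "HOL-Analysis.Convex" "HOL-Library.FuncSet"
begin

text \<open>
  The real linear space \<open>X\<close> is a type of class \<^class>\<open>real_vector\<close>; functions on \<open>D\<close> are total
  HOL functions whose values outside \<open>D\<close> are irrelevant. An \<open>n\<close>-tuple is a list of length \<open>n\<close>.
\<close>

definition ray :: "'b::real_vector \<Rightarrow> 'b set" where
  "ray x = {t *\<^sub>R x | t. 0 < t}"

text \<open>
  The library predicate \<^const>\<open>cone\<close> and the conic hull use multipliers \<open>t \<ge> 0\<close>; here only
  strictly positive multipliers are allowed, so \<open>0\<close> is in general not in the cone.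
\<close>

definition pos_cone :: "'b::real_vector set \<Rightarrow> 'b set" where
  "pos_cone S = {t *\<^sub>R x | t x. 0 < t \<and> x \<in> S}"

text \<open>
  Rays are meant for nonzero vectors only. This need not be demanded in the following definition:
  it is only used together with \<open>0 \<notin> convex hull S\<close>, which gives \<open>0 \<notin> S\<close>.
\<close>

definition observable :: "'b::real_vector set \<Rightarrow> bool" where
  "observable S \<longleftrightarrow> (\<forall>x\<in>S. \<forall>y\<in>S. x \<noteq> y \<longrightarrow> ray x \<inter> ray y = {})"

definition conically_convex :: "'b::real_vector set \<Rightarrow> bool" where
  "conically_convex S \<longleftrightarrow> convex (pos_cone S) \<and> 0 \<notin> convex hull S"

definition admissible :: "'a set \<Rightarrow> ('a \<Rightarrow> 'b::real_vector) \<Rightarrow> bool" where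
  "admissible D f \<longleftrightarrow> inj_on f D \<and> observable (f ` D) \<and> conically_convex (f ` D)"

text \<open>
  The next two functions are meaningful for admissible \<open>f\<close> and arguments in \<open>pos_cone (f ` D)\<close>.
\<close>

definition ray_proj :: "'a set \<Rightarrow> ('a \<Rightarrow> 'b::real_vector) \<Rightarrow> 'b \<Rightarrow> 'b" where
  "ray_proj D f y = (THE x. x \<in> f ` D \<and> y \<in> ray x)"

definition gen_inv :: "'a set \<Rightarrow> ('a \<Rightarrow> 'b::real_vector) \<Rightarrow> 'b \<Rightarrow> 'a" where
  "gen_inv D f = inv_into D f \<circ> ray_proj D f"

definition tuples :: "nat \<Rightarrow> 'a set \<Rightarrow> 'a list set" where
  "tuples n D = {xs. length xs = n \<and> set xs \<subseteq> D}"

definition weights :: "nat \<Rightarrow> real list set" where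
  "weights n = tuples n {0..} - {replicate n 0}"

definition weighted_tuples :: "'a set \<Rightarrow> ('a list \<times> real list) set" where
  "weighted_tuples D = (\<Union>n\<in>{1..}. tuples n D \<times> weights n)"

definition bajraktarevic_mean ::
    "'a set \<Rightarrow> ('a \<Rightarrow> 'b::real_vector) \<Rightarrow> 'a list \<times> real list \<Rightarrow> 'a" where
  "bajraktarevic_mean D f =
     (\<lambda>(xs, ls). gen_inv D f (\<Sum>k<length xs. (ls ! k) *\<^sub>R f (xs ! k)))"

text \<open>The first conjunct records the requirement that \<open>M\<close> maps weighted tuples over \<open>D\<close> into \<open>D\<close>.\<close>

definition casuative :: "'a set \<Rightarrow> ('a list \<times> real list \<Rightarrow> 'a) \<Rightarrow> bool" where
  "casuative D M \<longleftrightarrow>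
     M \<in> weighted_tuples D \<rightarrow> D \<and>
     (\<forall>(xs, ls) \<in> weighted_tuples D. \<forall>y\<in>D. \<forall>m>0.
        M (xs, ls) = M (xs @ [y], ls @ [m]) \<longleftrightarrow> y = M (xs, ls))"

end

theory Submission
  imports Defs
begin

text \<open>
  The mean of a weighted tuple is \<open>d\<close> exactly when the weighted sum of the vectors \<open>f x\<^sub>k\<close>
  lies on the ray through \<open>f d\<close> (\<open>gen_inv_eq_iff\<close>); the sum does lie on some such ray because
  the positive cone over \<open>f ` D\<close> is convex and hence closed under addition
  (\<open>weighted_sum_in_pos_cone\<close>). Appending an entry \<open>y\<close> with weight \<open>m > 0\<close> adds
  \<open>m *\<^sub>R f y\<close> to the sum. Since \<open>f\<close> is injective, casuativity says that a point moving from the ray through \<open>f d\<close> by a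
  positive multiple of \<open>f y\<close> remains on that ray if and only if \<open>f y = f d\<close>
  (\<open>add_scaled_in_ray_iff\<close>). If it remains there, then \<open>f y\<close> is a multiple of \<open>f d\<close>: a positive
  factor is the case treated by observability, and a factor \<open>\<le> 0\<close> would write \<open>0\<close> as a convex
  combination of \<open>f y\<close> and \<open>f d\<close>.
\<close>

lemma in_ray_iff: "v \<in> ray x \<longleftrightarrow> (\<exists>t>0. v = t *\<^sub>R x)"
  unfolding ray_def by auto

lemma in_pos_cone_iff: "v \<in> pos_cone S \<longleftrightarrow> (\<exists>x\<in>S. v \<in> ray x)"
  unfolding pos_cone_def ray_def by auto

lemma scaleR_in_pos_cone:
  assumes "v \<in> pos_cone S" "0 < t"
  shows "t *\<^sub>R v \<in> pos_cone S"
  using assms unfolding pos_cone_def by (force intro: mult_pos_pos)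

text \<open>Twice the midpoint of \<open>u\<close> and \<open>v\<close> is their sum.\<close>

lemma add_in_pos_cone:
  assumes "convex (pos_cone S)" "u \<in> pos_cone S" "v \<in> pos_cone S"
  shows "u + v \<in> pos_cone S"
proof -
  have "(1/2) *\<^sub>R u + (1/2) *\<^sub>R v \<in> pos_cone S"
    using assms by (intro convexD) auto
  then have "2 *\<^sub>R ((1/2) *\<^sub>R u + (1/2) *\<^sub>R v) \<in> pos_cone S"
    by (rule scaleR_in_pos_cone) simp
  then show ?thesis
    by (simp add: scaleR_add_right)
qed

text \<open>
  The positive cone need not contain \<open>0\<close>, so entries of weight \<open>0\<close> have to be discarded and one
  positive weight is required.
\<close>

lemma weighted_sum_in_pos_cone:
  assumes "convex (pos_cone S)" "finite I"
    and "\<And>i. i \<in> I \<Longrightarrow> g i \<in> S" "\<And>i. i \<in> I \<Longrightarrow> 0 \<le> c i"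
    and "\<exists>i\<in>I. c i \<noteq> 0"
  shows "(\<Sum>i\<in>I. c i *\<^sub>R g i) \<in> pos_cone S"
  using assms(2-)
proof (induction I rule: finite_induct)
  case empty
  then show ?case by simp
next
  case (insert j I)
  have summand: "c j *\<^sub>R g j \<in> pos_cone S" if "c j \<noteq> 0"
    using insert.prems(1,2)[of j] that unfolding pos_cone_def by force
  show ?case
  proof (cases "\<exists>i\<in>I. c i \<noteq> 0")
    case True
    then have "(\<Sum>i\<in>I. c i *\<^sub>R g i) \<in> pos_cone S"
      using insert by auto
    then show ?thesis
      using insert.hyps summand add_in_pos_cone[OF assms(1)] by (cases "c j = 0") auto
  next
    case False
    then show ?thesis
      using insert summand by auto
  qed
qed

lemma observable_ray_unique:
  assumes "observable S" "x \<in> S" "y \<in> S" "v \<in> ray x" "v \<in> ray y"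
  shows "x = y"
  using assms unfolding observable_def by blast

text \<open>
  The two hypotheses on \<open>S\<close> exclude the two ways in which \<open>y \<noteq> x\<close> could be parallel to \<open>x\<close>:
  observability the positive multiples, and \<open>0 \<notin> convex hull S\<close> the nonpositive ones.
\<close>

lemma add_scaled_in_ray_iff:
  assumes "observable S" "0 \<notin> convex hull S" "x \<in> S" "y \<in> S" "v \<in> ray x" "0 < m"
  shows "v + m *\<^sub>R y \<in> ray x \<longleftrightarrow> y = x"
proof
  obtain t where t: "0 < t" "v = t *\<^sub>R x"
    using \<open>v \<in> ray x\<close> by (auto simp: in_ray_iff)
  show "v + m *\<^sub>R y \<in> ray x" if "y = x"
    using t that \<open>0 < m\<close> by (auto simp: in_ray_iff scaleR_add_left intro!: exI[of _ "t + m"])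
  show "y = x" if on_ray: "v + m *\<^sub>R y \<in> ray x"
  proof -
    obtain s where s: "v + m *\<^sub>R y = s *\<^sub>R x"
      using on_ray by (auto simp: in_ray_iff)
    then have my: "m *\<^sub>R y = (s - t) *\<^sub>R x"
      using t by (simp add: algebra_simps)
    have "t < s"
    proof (rule ccontr)
      assume "\<not> t < s"
      define r where "r = m + (t - s)"
      have "0 < r" "0 \<le> (t - s) / r" "0 \<le> m / r" "m / r + (t - s) / r = 1"
        using \<open>0 < m\<close> \<open>\<not> t < s\<close> by (auto simp: r_def simp flip: add_divide_distrib)
      then have "(m / r) *\<^sub>R y + ((t - s) / r) *\<^sub>R x \<in> convex hull S"
        using assms(3,4) by (intro convexD[OF convex_convex_hull] hull_inc) auto
      moreover have "(m / r) *\<^sub>R y + ((t - s) / r) *\<^sub>R x = (1 / r) *\<^sub>R (m *\<^sub>R y + (t - s) *\<^sub>R x)"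
        by (simp add: scaleR_add_right)
      moreover have "m *\<^sub>R y + (t - s) *\<^sub>R x = 0"
        unfolding my by (simp flip: scaleR_add_left)
      ultimately show False
        using \<open>0 \<notin> convex hull S\<close> by simp
    qed
    then have "m *\<^sub>R y \<in> ray x"
      using my by (auto simp: in_ray_iff intro!: exI[of _ "s - t"])
    moreover have "m *\<^sub>R y \<in> ray y"
      using \<open>0 < m\<close> by (auto simp: in_ray_iff)
    ultimately show ?thesis
      using observable_ray_unique assms by metis
  qed
qed

lemma gen_inv_eqI:
  assumes "admissible D f" "d \<in> D" "v \<in> ray (f d)"
  shows "gen_inv D f v = d"
proof -
  have "observable (f ` D)" "inj_on f D"
    using assms(1) by (auto simp: admissible_def)
  then have "ray_proj D f v = f d"
    unfolding ray_proj_def using assms(2,3) observable_ray_unique[of "f ` D"]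
    by (intro the_equality) blast+
  then show ?thesis
    using \<open>inj_on f D\<close> \<open>d \<in> D\<close> by (simp add: gen_inv_def)
qed

lemma gen_inv_in:
  assumes "admissible D f" "v \<in> pos_cone (f ` D)"
  shows "gen_inv D f v \<in> D"
  using assms gen_inv_eqI[OF assms(1)] by (auto simp: in_pos_cone_iff)

lemma gen_inv_eq_iff:
  assumes "admissible D f" "v \<in> pos_cone (f ` D)" "d \<in> D"
  shows "gen_inv D f v = d \<longleftrightarrow> v \<in> ray (f d)"
  using assms gen_inv_eqI[OF assms(1)] by (auto simp: in_pos_cone_iff)

lemma weighted_sum_of_weighted_tuple:
  assumes "convex (pos_cone (f ` D))" "(xs, ls) \<in> weighted_tuples D"
  shows "(\<Sum>k<length xs. (ls ! k) *\<^sub>R f (xs ! k)) \<in> pos_cone (f ` D)"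
proof (rule weighted_sum_in_pos_cone[OF assms(1)])
  have len: "length ls = length xs" and D: "set xs \<subseteq> D" and nonneg: "set ls \<subseteq> {0..}"
    and nonzero: "ls \<noteq> replicate (length xs) 0"
    using assms(2) by (auto simp: weighted_tuples_def weights_def tuples_def)
  show "f (xs ! k) \<in> f ` D" if "k \<in> {..<length xs}" for k
    using that D by (auto dest: nth_mem)
  show "0 \<le> ls ! k" if "k \<in> {..<length xs}" for k
    using that nonneg len by (metis atLeast_iff lessThan_iff nth_mem subsetD)
  show "\<exists>k\<in>{..<length xs}. ls ! k \<noteq> 0"
    using nonzero len by (auto simp: list_eq_iff_nth_eq)
qed simp

lemma weighted_tuples_append:
  assumes "(xs, ls) \<in> weighted_tuples D" "y \<in> D" "0 < m"
  shows "(xs @ [y], ls @ [m]) \<in> weighted_tuples D"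
  using assms by (auto simp: weighted_tuples_def weights_def tuples_def append_eq_conv_conj
      simp flip: replicate_append_same)

theorem proposition4p5:
  fixes D :: "'a set" and f :: "'a \<Rightarrow> 'b::real_vector"
  assumes "admissible D f"
  shows "casuative D (bajraktarevic_mean D f)"
proof -
  define Z where "Z = (\<lambda>(xs, ls). \<Sum>k<length xs. (ls ! k) *\<^sub>R f (xs ! k))"
  have mean: "bajraktarevic_mean D f p = gen_inv D f (Z p)" for p
    by (simp add: bajraktarevic_mean_def Z_def split: prod.split)
  have obs: "observable (f ` D)" and inj: "inj_on f D"
    and conv: "convex (pos_cone (f ` D))" and hull: "0 \<notin> convex hull (f ` D)"
    using assms by (auto simp: admissible_def conically_convex_def)
  have Z_cone: "Z p \<in> pos_cone (f ` D)" if "p \<in> weighted_tuples D" for p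
    using weighted_sum_of_weighted_tuple[OF conv] that by (cases p) (auto simp: Z_def)
  have "bajraktarevic_mean D f (xs, ls) = bajraktarevic_mean D f (xs @ [y], ls @ [m])
      \<longleftrightarrow> y = bajraktarevic_mean D f (xs, ls)"
    if p: "(xs, ls) \<in> weighted_tuples D" and y: "y \<in> D" and m: "0 < m" for xs ls y m
  proof -
    define d where "d = gen_inv D f (Z (xs, ls))"
    have d: "d \<in> D" "Z (xs, ls) \<in> ray (f d)"
      using gen_inv_in[OF assms Z_cone[OF p]] gen_inv_eq_iff[OF assms Z_cone[OF p]]
      by (auto simp: d_def)
    have "length ls = length xs"
      using p by (auto simp: weighted_tuples_def weights_def tuples_def)
    then have "Z (xs @ [y], ls @ [m]) = Z (xs, ls) + m *\<^sub>R f y"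
      by (simp add: Z_def nth_append)
    then have "gen_inv D f (Z (xs @ [y], ls @ [m])) = d \<longleftrightarrow> Z (xs, ls) + m *\<^sub>R f y \<in> ray (f d)"
      using gen_inv_eq_iff[OF assms Z_cone[OF weighted_tuples_append[OF p y m]] d(1)] by simp
    also have "\<dots> \<longleftrightarrow> f y = f d"
      using add_scaled_in_ray_iff[OF obs hull] d y m by simp
    also have "\<dots> \<longleftrightarrow> y = d"
      using inj y d(1) by (simp add: inj_on_eq_iff)
    finally show ?thesis
      unfolding mean d_def by auto
  qed
  moreover have "bajraktarevic_mean D f \<in> weighted_tuples D \<rightarrow> D"
    using gen_inv_in[OF assms Z_cone] by (auto simp: mean)
  ultimately show ?thesis
    unfolding casuative_def by auto
qed

end
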